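(* Let $D$ be a division ring with center $F$, and let $n\ge 2$ be an integer. Suppose $F$ is a finite field with $q$ elements, where $q>n$. Then every matrix in $\mathrm{M}_n(D)$ can be expressed as a product of two commutators in $\mathrm{M}_n(D)$.
   Context: $\mathrm{M}_n(D)$ is the ring of $n\times n$ matrices over $D$. A commutator in a ring $S$ is an (additive commutator) element $[a,b]=ab-ba$ with $a,b\in S$. *)

theory Defs
  imports "Jordan_Normal_Form.Matrix"
begin

definition ring_center :: "'a::ring_1 set" where
  "ring_center = {z. \<forall>x. z * x = x * z}"

(* Multiplication of 'a mat is total; restricting A and B to carrier_mat n n makes this
   the commutator notion of the ring M_n(D), where D is the whole type 'a. *)
definition mat_commutator :: "nat \<Rightarrow> 'a::ring_1 mat \<Rightarrow> bool" where
  "mat_commutator n C \<longleftrightarrow>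
     (\<exists>A \<in> carrier_mat n n. \<exists>B \<in> carrier_mat n n. C = A * B - B * A)"

end

theory Submission
  imports Defs "HOL-Combinatorics.Permutations"
begin

text \<open>
  Being a product of two commutators is invariant under similarity. A central scalar matrix \<open>z I\<close> is
  \<open>C (z C\<^sup>-\<^sup>1)\<close> for a cyclic permutation matrix \<open>C\<close>, and a matrix with zero diagonal is a commutator
  with a diagonal matrix that has distinct central entries.

  A matrix \<open>M\<close> that is not a central scalar is similar to one with any prescribed entry \<open>p\<close> at
  \<open>(0, 0)\<close>. As in Sourour's factorization theorem, one splits off this entry and continues with the
  Schur complement, which can be kept nonscalar or zero. Stopping at size 2 gives \<open>M\<close> similar to \<open>X Y\<close>
  with \<open>Y\<close> upper triangular and \<open>X\<close> lower triangular except for a final block with rows \<open>(s, e)\<close>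
  and \<open>(c, 0)\<close>. The freedom in \<open>p\<close>, \<open>s\<close>, \<open>c\<close>, \<open>e\<close> makes both traces literally zero, and
  matrices of these two shapes with zero trace are commutators. Only singular \<open>2 \<times> 2\<close> matrices
  escape this; they have rank one and are factored explicitly.
\<close>

section \<open>Commutators\<close>

lemma mult_mat_entry:
  assumes "A \<in> carrier_mat n m" "B \<in> carrier_mat m l" "i < n" "j < l"
  shows "(A * B) $$ (i,j) = (\<Sum>k<m. A $$ (i,k) * B $$ (k,j))"
  using assms by (auto simp: scalar_prod_def lessThan_atLeast0 intro!: sum.cong)

lemma mat_commutatorI:
  assumes "A \<in> carrier_mat n n" "B \<in> carrier_mat n n" "C = A * B - B * A"
  shows "mat_commutator n C"
  using assms unfolding mat_commutator_def by blast

lemma mat_commutator_carrier: "mat_commutator n C \<Longrightarrow> C \<in> carrier_mat n n"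
  unfolding mat_commutator_def by auto

lemma mat_commutator_conj:
  assumes "mat_commutator n C" "P \<in> carrier_mat n n" "Q \<in> carrier_mat n n" "Q * P = 1\<^sub>m n"
  shows "mat_commutator n (P * C * Q)"
proof -
  obtain A B where AB: "A \<in> carrier_mat n n" "B \<in> carrier_mat n n" "C = A * B - B * A"
    using assms(1) unfolding mat_commutator_def by blast
  have prod: "(P * U * Q) * (P * V * Q) = P * (U * V) * Q"
    if "U \<in> carrier_mat n n" "V \<in> carrier_mat n n" for U V
  proof -
    have "(P * U * Q) * (P * V * Q) = P * U * ((Q * P) * (V * Q))"
      using that assms(2,3) by (simp add: assoc_mult_mat[of _ n n _ n _ n])
    also have "\<dots> = P * (U * V) * Q"
      using that assms(2-4) by (simp add: assoc_mult_mat[of _ n n _ n _ n])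
    finally show ?thesis .
  qed
  have "P * C * Q = P * (A * B) * Q - P * (B * A) * Q"
    unfolding AB(3) using AB(1,2) assms(2,3)
    by (simp add: mult_minus_distrib_mat[of _ n n _ n] minus_mult_distrib_mat[of _ n n _ _ n])
  then have "P * C * Q = (P * A * Q) * (P * B * Q) - (P * B * Q) * (P * A * Q)"
    using prod AB by simp
  then show ?thesis using AB assms by (intro mat_commutatorI[of "P * A * Q" n "P * B * Q"]) auto
qed

definition commutator_product :: "nat \<Rightarrow> 'a::ring_1 mat \<Rightarrow> bool" where
  "commutator_product n M \<longleftrightarrow> (\<exists>X Y. mat_commutator n X \<and> mat_commutator n Y \<and> M = X * Y)"

lemma commutator_product_similar:
  assumes "similar_mat M N" "commutator_product n N"
  shows "commutator_product n M"
proof -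
  obtain X Y where XY: "mat_commutator n X" "mat_commutator n Y" "N = X * Y"
    using assms(2) unfolding commutator_product_def by blast
  have c: "X \<in> carrier_mat n n" "Y \<in> carrier_mat n n" using XY mat_commutator_carrier by auto
  obtain P Q where PQ: "similar_mat_wit N M P Q"
    using similar_mat_sym[OF assms(1)] unfolding similar_mat_def by blast
  have N: "N \<in> carrier_mat n n" using XY c by auto
  note w = similar_mat_witD2[OF N PQ]
  note w' = similar_mat_witD2[OF w(5) similar_mat_wit_sym[OF PQ]]
  have "M = (Q * X * P) * (Q * Y * P)"
  proof -
    have "(Q * X * P) * (Q * Y * P) = Q * X * ((P * Q) * (Y * P))"
      using c w(6,7) by (simp add: assoc_mult_mat[of _ n n _ n _ n])
    also have "\<dots> = Q * (X * Y) * P"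
      using c w(1,6,7) by (simp add: assoc_mult_mat[of _ n n _ n _ n])
    finally show ?thesis using w'(3) XY(3) by simp
  qed
  then show ?thesis
    unfolding commutator_product_def
    using mat_commutator_conj[OF XY(1) w(7,6) w(1)] mat_commutator_conj[OF XY(2) w(7,6) w(1)]
    by blast
qed

section \<open>Matrix shapes that are commutators\<close>

lemma zero_diagonal_mat_commutator:
  fixes C :: "'a::division_ring mat" and d :: "nat \<Rightarrow> 'a"
  assumes C: "C \<in> carrier_mat n n" "\<And>i. i < n \<Longrightarrow> C $$ (i,i) = 0"
    and d: "inj_on d {..<n}" "\<And>i. i < n \<Longrightarrow> d i \<in> ring_center"
  shows "mat_commutator n C"
proof (rule mat_commutatorI)
  define A where "A = mat n n (\<lambda>(i,j). if i = j then d i else (0::'a))"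
  \<comment> \<open>Since \<open>d j\<close> is central, the entry of \<open>A * B - B * A\<close>
    is \<open>(d i - d j) * B $$ (i,j)\<close>, which is solved by division. On the diagonal
    \<open>inverse 0 = 0\<close> makes \<open>B\<close> vanish, consistent with the zero diagonal of
    \<open>C\<close>.\<close>
  define B where "B = mat n n (\<lambda>(i,j). inverse (d i - d j) * C $$ (i,j))"
  show A: "A \<in> carrier_mat n n" and B: "B \<in> carrier_mat n n" by (auto simp: A_def B_def)
  show "C = A * B - B * A"
  proof (rule eq_matI)
    fix i j assume "i < dim_row (A * B - B * A)" "j < dim_col (A * B - B * A)"
    then have ij: "i < n" "j < n" using A B by auto
    have "(A * B) $$ (i,j) = d i * B $$ (i,j)"
      using ij by (subst mult_mat_entry[OF A B])
        (auto simp: A_def if_distrib[of "\<lambda>x. x * _"] cong: if_cong)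
    moreover have "(B * A) $$ (i,j) = B $$ (i,j) * d j"
      using ij by (subst mult_mat_entry[OF B A])
        (auto simp: A_def if_distrib[of "\<lambda>x. _ * x"] cong: if_cong)
    moreover have "B $$ (i,j) * d j = d j * B $$ (i,j)"
      using d(2)[OF ij(2)] by (simp add: ring_center_def)
    ultimately have "(A * B - B * A) $$ (i,j) = (d i - d j) * B $$ (i,j)"
      using ij A B by (simp add: left_diff_distrib)
    also have "\<dots> = C $$ (i,j)"
    proof (cases "i = j")
      case False
      then have "d i - d j \<noteq> 0" using d(1) ij by (auto dest: inj_onD)
      then show ?thesis using ij by (simp add: B_def mult.assoc[symmetric])
    qed (use C ij in simp)
    finally show "C $$ (i,j) = (A * B - B * A) $$ (i,j)" by simp
  qed (use C A B in auto)
qed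

text \<open>Solves \<open>Y = J B - B J\<close> for the shift \<open>J\<close> with ones on the superdiagonal, row by row.\<close>

fun shift_solution :: "(nat \<Rightarrow> nat \<Rightarrow> 'a::ring_1) \<Rightarrow> nat \<Rightarrow> nat \<Rightarrow> 'a" where
  "shift_solution Y 0 j = 0"
| "shift_solution Y (Suc i) 0 = Y i 0"
| "shift_solution Y (Suc i) (Suc j) = Y i (Suc j) + shift_solution Y i j"

text \<open>The recursion moves up along diagonals, so below the subdiagonal it only collects
  entries of \<open>Y\<close> below its diagonal.\<close>

lemma shift_solution_below:
  assumes "\<And>i j. j < i \<Longrightarrow> i < n \<Longrightarrow> Y i j = 0" "Suc j < i" "i \<le> n"
  shows "shift_solution Y i j = 0"
  using assms by (induction Y i j rule: shift_solution.induct) auto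

text \<open>The subdiagonal collects the partial traces of \<open>Y\<close>; this is how the trace
  condition enters.\<close>

lemma shift_solution_subdiagonal: "shift_solution Y (Suc i) i = (\<Sum>k\<le>i. Y k k)"
  by (induction i) (auto simp: add.commute)

text \<open>All rows but the last hold by the recursion. The last needs the virtual row
  \<open>n\<close> of the solution to vanish: triangularity kills it left of the subdiagonal
  position, and the zero trace kills that position.\<close>

lemma shift_solution:
  assumes Y: "\<And>i j. j < i \<Longrightarrow> i < n \<Longrightarrow> Y i j = 0" and tr: "(\<Sum>k<n. Y k k) = 0"
    and ij: "i < n" "j < n"
  shows "Y i j = (if Suc i < n then shift_solution Y (Suc i) j else 0)
    - (if j = 0 then 0 else shift_solution Y i (j - 1))"
proof (cases "Suc i < n")
  case True
  then show ?thesis by (cases j) auto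
next
  case False
  then have i: "n = Suc i" using ij by simp
  have "shift_solution Y (Suc i) j = 0"
  proof (cases "j = i")
    case True
    then show ?thesis using tr i by (simp add: shift_solution_subdiagonal lessThan_Suc_atMost)
  next
    case False
    then show ?thesis using shift_solution_below[of "Suc i" Y j "Suc i"] Y ij i by auto
  qed
  then show ?thesis using False by (cases j) (auto simp: eq_neg_iff_add_eq_0)
qed

lemma upper_triangular_mat_commutator:
  fixes Y :: "'a::ring_1 mat"
  assumes Y: "Y \<in> carrier_mat n n" "upper_triangular Y" "(\<Sum>i<n. Y $$ (i,i)) = 0"
  shows "mat_commutator n Y"
proof (rule mat_commutatorI)
  define b where "b = shift_solution (\<lambda>i j. Y $$ (i,j))"
  define A where "A = mat n n (\<lambda>(i,j). if j = Suc i then 1 else (0::'a))"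
  define B where "B = mat n n (\<lambda>(i,j). b i j)"
  show A: "A \<in> carrier_mat n n" and B: "B \<in> carrier_mat n n" by (auto simp: A_def B_def)
  show "Y = A * B - B * A"
  proof (rule eq_matI)
    fix i j assume "i < dim_row (A * B - B * A)" "j < dim_col (A * B - B * A)"
    then have ij: "i < n" "j < n" using A B by auto
    have "(A * B) $$ (i,j) = (if Suc i < n then b (Suc i) j else 0)"
      using ij by (subst mult_mat_entry[OF A B])
        (auto simp: A_def B_def if_distrib[of "\<lambda>x. x * _"] cong: if_cong)
    moreover have "(B * A) $$ (i,j) = (if j = 0 then 0 else b i (j - 1))"
      using ij by (subst mult_mat_entry[OF B A], (simp; fail)+, cases j)
        (auto simp: A_def B_def if_distrib[of "\<lambda>x. _ * x"] cong: if_cong)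
    moreover have "Y $$ (i,j) = (if Suc i < n then b (Suc i) j else 0)
        - (if j = 0 then 0 else b i (j - 1))"
      unfolding b_def by (rule shift_solution) (use Y ij in auto)
    ultimately show "Y $$ (i,j) = (A * B - B * A) $$ (i,j)" using ij A B by simp
  qed (use Y A B in auto)
qed

text \<open>The entry at \<open>(n - 2, n - 1)\<close> is unconstrained.\<close>

definition almost_lower :: "nat \<Rightarrow> 'a::zero mat \<Rightarrow> bool" where
  "almost_lower n X \<longleftrightarrow> X $$ (n - 1, n - 1) = 0 \<and>
    (\<forall>i j. i < j \<longrightarrow> j < n \<longrightarrow> \<not> (Suc j = n \<and> Suc i = j) \<longrightarrow> X $$ (i,j) = 0)"

text \<open>Here \<open>A\<close> is the direct sum of a nilpotent shift and the \<open>1 \<times> 1\<close> matrix \<open>1\<close>: their spectra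
  are disjoint, so the last row and column can be solved for separately.\<close>

lemma almost_lower_mat_commutator:
  fixes X :: "'a::ring_1 mat"
  assumes X: "X \<in> carrier_mat n n" "almost_lower n X" "(\<Sum>i<n. X $$ (i,i)) = 0" and n: "n \<ge> 2"
  shows "mat_commutator n X"
proof -
  obtain m where m: "n = Suc (Suc m)" using n by (metis add_2_eq_Suc le_Suc_ex)
  define b where "b = shift_solution (\<lambda>i j. X $$ (j,i))"
  define A where "A = mat n n (\<lambda>(i,j). if i = Suc j \<and> i \<le> m \<or> i = Suc m \<and> j = i then 1 else (0::'a))"
  \<comment> \<open>On the leading block this is the transposed shift problem, and transposing a
    commutator flips its sign, hence \<open>- b j i\<close>. The last row must satisfy
    \<open>B $$ (Suc m, j) - B $$ (Suc m, Suc j) = X $$ (Suc m, j)\<close> for \<open>j < m\<close>,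
    so it consists of suffix sums. In the last column only the free entry of \<open>X\<close> has to
    be matched.\<close>
  define B where "B = mat n n (\<lambda>(i,j).
    if j = Suc m then if i = m then - X $$ (m, Suc m) else 0
    else if i = Suc m then \<Sum>k\<in>{j..m}. X $$ (Suc m, k) else - b j i)"
  have A: "A \<in> carrier_mat n n" and B: "B \<in> carrier_mat n n" by (auto simp: A_def B_def)
  have Xz: "X $$ (i,j) = 0" if "i < j" "j < n" "\<not> (j = Suc m \<and> i = m)" for i j
    using X(2) that m unfolding almost_lower_def by auto
  have Xl: "X $$ (Suc m, Suc m) = 0" using X(2) m unfolding almost_lower_def by auto
  have "X = A * B - B * A"
  proof (rule eq_matI)
    fix i j assume "i < dim_row (A * B - B * A)" "j < dim_col (A * B - B * A)"
    then have ij: "i < n" "j < n" using A B by auto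
    have AB: "(A * B) $$ (i,j) = (if i = Suc m then B $$ (i,j) else if i = 0 then 0 else B $$ (i-1,j))"
    proof -
      \<comment> \<open>Each row of \<open>A\<close> has at most one nonzero entry. Row 0 has none,
        and the guard on \<open>i\<close> keeps the truncated \<open>0 - 1\<close> from selecting
        one.\<close>
      have "(A * B) $$ (i,j) = (\<Sum>k<n. if k = (if i = Suc m then i else i - 1) \<and> i \<noteq> 0 then B $$ (k,j) else 0)"
        using ij m by (subst mult_mat_entry[OF A B]) (auto simp: A_def intro!: sum.cong)
      also have "\<dots> = (if i = Suc m then B $$ (i,j) else if i = 0 then 0 else B $$ (i-1,j))"
        using ij m by (cases "i = 0") auto
      finally show ?thesis .
    qed
    have BA: "(B * A) $$ (i,j) = (if j = Suc m then B $$ (i,j) else if j = m then 0 else B $$ (i,Suc j))"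
    proof -
      have "(B * A) $$ (i,j) = (\<Sum>k<n. if k = (if j = Suc m then j else Suc j) \<and> j \<noteq> m then B $$ (i,k) else 0)"
        using ij m by (subst mult_mat_entry[OF B A]) (auto simp: A_def intro!: sum.cong)
      also have "\<dots> = (if j = Suc m then B $$ (i,j) else if j = m then 0 else B $$ (i,Suc j))"
        using ij m by (cases "j = m") auto
      finally show ?thesis .
    qed
    \<comment> \<open>The last diagonal entry of \<open>X\<close> is zero, so the leading block of
      size \<open>Suc m\<close> has trace zero by itself.\<close>
    have shift: "X $$ (i,j) = (if Suc j < Suc m then b (Suc j) i else 0)
        - (if i = 0 then 0 else b j (i - 1))" if "i \<le> m" "j \<le> m"
      unfolding b_def by (rule shift_solution[where Y = "\<lambda>i j. X $$ (j,i)" and n = "Suc m"])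
        (use Xz Xl X(3) m that in auto)
    have tail: "(\<Sum>k\<in>{j..m}. X $$ (Suc m, k)) = X $$ (Suc m, j) + (\<Sum>k\<in>{Suc j..m}. X $$ (Suc m, k))"
      if "j \<le> m" using that by (rule sum.atLeast_Suc_atMost)
    have "(A * B - B * A) $$ (i,j) = (A * B) $$ (i,j) - (B * A) $$ (i,j)" using ij A B by simp
    also have "\<dots> = X $$ (i,j)"
    proof (cases "i = Suc m")
      case True
      then show ?thesis unfolding AB BA using ij m Xl tail
        by (cases "j = Suc m"; cases "j = m") (auto simp: B_def)
    next
      case False
      then have i: "i \<le> m" using ij m by simp
      show ?thesis
      proof (cases "j = Suc m")
        case True
        then show ?thesis unfolding AB BA using ij m i Xz[of i j] by (auto simp: B_def)
      next
        case False
        then have j: "j \<le> m" using ij m by simp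
        show ?thesis unfolding AB BA using i j m shift[OF i j] by (auto simp: B_def)
      qed
    qed
    finally show "X $$ (i,j) = (A * B - B * A) $$ (i,j)" by simp
  qed (use X A B in auto)
  then show ?thesis by (rule mat_commutatorI[OF A B])
qed


section \<open>Similarity over division rings\<close>

lemma similar_matI':
  assumes M: "M \<in> carrier_mat n n" and P: "P \<in> carrier_mat n n" and Q: "Q \<in> carrier_mat n n"
    and PQ: "P * Q = 1\<^sub>m n" and QP: "Q * P = 1\<^sub>m n" and N: "N = Q * (M * P)"
  shows "similar_mat M N"
proof (rule similar_mat_sym, rule similar_matI)
  show "{N, M, Q, P} \<subseteq> carrier_mat n n" using M P Q N by auto
  show "N = Q * M * P" using M P Q N by (simp add: assoc_mult_mat[of _ n n _ n _ n])
qed (use PQ QP in auto)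

lemma similar_mat_permute:
  assumes M: "M \<in> carrier_mat n n" and p: "p permutes {..<n}"
  shows "similar_mat M (mat n n (\<lambda>(i,j). M $$ (p i, p j)))"
proof (rule similar_matI'[OF M])
  define P where "P = mat n n (\<lambda>(i,j). if i = p j then 1 else (0::'a))"
  define Q where "Q = mat n n (\<lambda>(i,j). if j = p i then 1 else (0::'a))"
  show P: "P \<in> carrier_mat n n" and Q: "Q \<in> carrier_mat n n" by (auto simp: P_def Q_def)
  have pn: "p i < n" if "i < n" for i using permutes_in_image[OF p, of i] that by simp
  have pinj: "p i = p j \<longleftrightarrow> i = j" for i j using permutes_inj[OF p] by (auto dest: injD)
  have MP: "(M * P) $$ (i,j) = M $$ (i, p j)" if "i < n" "j < n" for i j
    using that pn by (subst mult_mat_entry[OF M P])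
      (auto simp: P_def if_distrib[of "\<lambda>x. _ * x"] cong: if_cong)
  have QX: "(Q * X) $$ (i,j) = X $$ (p i, j)" if "i < n" "j < n" "X \<in> carrier_mat n n" for i j X
    using that pn by (subst mult_mat_entry[OF Q that(3)])
      (auto simp: Q_def if_distrib[of "\<lambda>x. x * _"] cong: if_cong)
  show "mat n n (\<lambda>(i,j). M $$ (p i, p j)) = Q * (M * P)"
    by (rule eq_matI) (use M P Q QX[of _ _ "M * P"] MP pn in auto)
  show "Q * P = 1\<^sub>m n"
    by (rule eq_matI) (use P Q QX[OF _ _ P] pn in \<open>auto simp: P_def pinj\<close>)
  show "P * Q = 1\<^sub>m n"
  proof (rule eq_matI)
    fix i j assume "i < dim_row (1\<^sub>m n)" "j < dim_col (1\<^sub>m n)"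
    then have ij: "i < n" "j < n" by auto
    have "(P * Q) $$ (i,j) = (\<Sum>k<n. if p k = i \<and> p k = j then 1 else 0)"
      using ij by (subst mult_mat_entry[OF P Q]) (auto simp: P_def Q_def intro!: sum.cong)
    also have "\<dots> = (\<Sum>k<n. if k = i \<and> k = j then 1 else 0)"
      using sum.permute[OF p, of "\<lambda>k. if k = i \<and> k = j then 1 else (0::'a)"] by (simp add: o_def)
    also have "\<dots> = 1\<^sub>m n $$ (i,j)" using ij by (cases "i = j") (auto intro!: sum.neutral)
    finally show "(P * Q) $$ (i,j) = 1\<^sub>m n $$ (i,j)" .
  qed (use P Q in auto)
qed

text \<open>Replacing the \<open>k\<close>-th basis vector by the vector \<open>w\<close>.\<close>

definition column_conjugate :: "nat \<Rightarrow> nat \<Rightarrow> (nat \<Rightarrow> 'a) \<Rightarrow> 'a mat \<Rightarrow> 'a::division_ring mat" where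
  "column_conjugate n k w M =
     (let X = \<lambda>i j. if j = k then \<Sum>t<n. M $$ (i,t) * w t else M $$ (i,j)
      in mat n n (\<lambda>(i,j). if i = k then inverse (w k) * X k j
                          else X i j - w i * inverse (w k) * X k j))"

lemma column_conjugate_similar:
  fixes M :: "'a::division_ring mat"
  assumes M: "M \<in> carrier_mat n n" and k: "k < n" and w: "w k \<noteq> 0"
  shows "similar_mat M (column_conjugate n k w M)"
proof (rule similar_matI'[OF M])
  define R where "R v = mat n n (\<lambda>(i,j). if j = k then v i else if i = j then 1 else (0::'a))" for v
  \<comment> \<open>\<open>R u\<close> is the identity with column \<open>k\<close> replaced by
    \<open>u\<close>; this \<open>v\<close> is the column for which \<open>R v\<close> inverts
    \<open>R w\<close>.\<close>
  define v where "v i = (if i = k then inverse (w k) else - w i * inverse (w k))" for i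
  have R: "R u \<in> carrier_mat n n" for u by (auto simp: R_def)
  have XR: "(X * R u) $$ (i,j) = (if j = k then \<Sum>t<n. X $$ (i,t) * u t else X $$ (i,j))"
    if "i < n" "j < n" "X \<in> carrier_mat n n" for i j X u
    using that by (subst mult_mat_entry[OF that(3) R])
      (auto simp: R_def if_distrib[of "\<lambda>x. _ * x"] cong: if_cong)
  have RX: "(R u * X) $$ (i,j) = (if i = k then 0 else X $$ (i,j)) + u i * X $$ (k,j)"
    if "i < n" "j < n" "X \<in> carrier_mat n n" for i j X u
  proof -
    have "(R u * X) $$ (i,j) = (\<Sum>t<n. (if t = i \<and> i \<noteq> k then X $$ (i,j) else 0)
        + (if t = k then u i * X $$ (k,j) else 0))"
      using that by (subst mult_mat_entry[OF R that(3)]) (auto simp: R_def intro!: sum.cong)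
    also have "\<dots> = (if i = k then 0 else X $$ (i,j)) + u i * X $$ (k,j)"
      using that k by (cases "i = k") (auto simp: sum.distrib)
    finally show ?thesis .
  qed
  show "R w \<in> carrier_mat n n" "R v \<in> carrier_mat n n" by (rule R)+
  show "R w * R v = 1\<^sub>m n"
    by (rule eq_matI) (use RX[OF _ _ R] R k w in \<open>auto simp: R_def v_def\<close>)
  show "R v * R w = 1\<^sub>m n"
    by (rule eq_matI) (use RX[OF _ _ R] R k w in \<open>auto simp: R_def v_def mult.assoc\<close>)
  show "column_conjugate n k w M = R v * (M * R w)"
    by (rule eq_matI) (use RX[of _ _ "M * R w"] XR[OF _ _ M] M R k carrier_matD[OF R] in
      \<open>auto simp: column_conjugate_def Let_def v_def mult.assoc simp del: index_mult_mat(1)\<close>)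
qed

section \<open>Normalizing nonscalar matrices; Schur complements\<close>

definition central_scalar :: "nat \<Rightarrow> 'a::ring_1 mat \<Rightarrow> bool" where
  "central_scalar n M \<longleftrightarrow> (\<exists>z\<in>ring_center. M = z \<cdot>\<^sub>m 1\<^sub>m n)"

lemma central_scalar_off_diagonal:
  assumes "central_scalar n M" "i < n" "j < n" "i \<noteq> j"
  shows "M $$ (i,j) = 0"
  using assms unfolding central_scalar_def by auto

text \<open>A diagonal matrix for which \<open>M $$ (j,j) * x = x * M $$ (i,i)\<close> holds for all
  \<open>i\<close>, \<open>j\<close>, \<open>x\<close> with distinct \<open>i\<close>,
  \<open>j\<close> is a central scalar: \<open>x = 1\<close> equates the diagonal entries, general
  \<open>x\<close> makes them central. Where the identity fails, replacing the basis vector e_i by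
  e_i + e_j x puts the difference of the two sides at \<open>(j,i)\<close>.\<close>

lemma similar_off_diagonal:
  fixes M :: "'a::division_ring mat"
  assumes M: "M \<in> carrier_mat n n" and n: "n \<ge> 2" and ns: "\<not> central_scalar n M"
  obtains N i j where "similar_mat M N" "N \<in> carrier_mat n n" "i < n" "j < n" "i \<noteq> j"
    "N $$ (i,j) \<noteq> 0"
proof (cases "\<exists>i j. i < n \<and> j < n \<and> i \<noteq> j \<and> M $$ (i,j) \<noteq> 0")
  case True
  then show ?thesis using that[OF similar_mat_refl[OF M] M] by blast
next
  case False
  then have diag: "M $$ (i,j) = 0" if "i < n" "j < n" "i \<noteq> j" for i j using that by blast
  have "\<exists>i j x. i < n \<and> j < n \<and> i \<noteq> j \<and> M $$ (j,j) * x \<noteq> x * M $$ (i,i)"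
  proof (rule ccontr)
    assume "\<not> ?thesis"
    then have eq: "M $$ (j,j) * x = x * M $$ (i,i)" if "i < n" "j < n" "i \<noteq> j" for i j x
      using that by blast
    have const: "M $$ (j,j) = M $$ (0,0)" if "j < n" for j
      using eq[of 0 j 1] n that by (cases "j = 0") auto
    have "M $$ (0,0) * x = x * M $$ (0,0)" for x
      using eq[of 0 1 x] const[of 1] n by auto
    then have "M $$ (0,0) \<in> ring_center" by (simp add: ring_center_def)
    moreover have "M = M $$ (0,0) \<cdot>\<^sub>m 1\<^sub>m n"
    proof (rule eq_matI)
      fix i j assume "i < dim_row (M $$ (0,0) \<cdot>\<^sub>m 1\<^sub>m n)" "j < dim_col (M $$ (0,0) \<cdot>\<^sub>m 1\<^sub>m n)"
      then show "M $$ (i,j) = (M $$ (0,0) \<cdot>\<^sub>m 1\<^sub>m n) $$ (i,j)"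
        using const[of j] diag[of i j] by (cases "i = j") simp_all
    qed (use M in auto)
    ultimately show False using ns unfolding central_scalar_def by blast
  qed
  then obtain i j x where ij: "i < n" "j < n" "i \<noteq> j" "M $$ (j,j) * x \<noteq> x * M $$ (i,i)" by blast
  define w where "w t = (if t = i then 1 else if t = j then x else 0)" for t
  define N where "N = column_conjugate n i w M"
  have "(\<Sum>t<n. M $$ (i,t) * w t) = M $$ (i,i)"
    using ij diag by (subst sum.remove[of _ i]) (auto simp: w_def intro!: sum.neutral)
  moreover have "(\<Sum>t<n. M $$ (j,t) * w t) = M $$ (j,j) * x"
    using ij diag by (subst sum.remove[of _ j]) (auto simp: w_def intro!: sum.neutral)
  ultimately have "N $$ (j,i) = M $$ (j,j) * x - x * M $$ (i,i)"
    using ij by (simp add: N_def column_conjugate_def Let_def w_def)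
  then have "N $$ (j,i) \<noteq> 0" using ij by simp
  moreover have "similar_mat M N"
    unfolding N_def using M ij by (intro column_conjugate_similar) (auto simp: w_def)
  moreover have "N \<in> carrier_mat n n" by (simp add: N_def column_conjugate_def Let_def)
  ultimately show ?thesis using that ij by blast
qed

text \<open>Once a nonzero entry sits at \<open>(1,0)\<close>, the vector B e_0 - e_0 p can replace
  e_1 in the basis. In the new basis e_0 is mapped to e_0 p + e_1, which is the required first
  column.\<close>

lemma similar_first_column:
  fixes M :: "'a::division_ring mat"
  assumes M: "M \<in> carrier_mat n n" and n: "n \<ge> 2" and ns: "\<not> central_scalar n M"
  obtains N where "similar_mat M N" "N \<in> carrier_mat n n" "N $$ (0,0) = p" "N $$ (1,0) = 1"
    "\<And>i. 2 \<le> i \<Longrightarrow> i < n \<Longrightarrow> N $$ (i,0) = 0"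
proof -
  obtain A i j where A: "similar_mat M A" "A \<in> carrier_mat n n"
    and ij: "i < n" "j < n" "i \<noteq> j" "A $$ (i,j) \<noteq> 0"
    using similar_off_diagonal[OF M n ns] .
  \<comment> \<open>\<open>k\<close> is the preimage of \<open>i\<close> under the swap of 0 and
    \<open>j\<close>, so the composite sends 0 to \<open>j\<close> and 1 to
    \<open>i\<close>.\<close>
  define k where "k = transpose 0 j i"
  define \<pi> where "\<pi> = transpose 0 j \<circ> transpose 1 k"
  have k: "k \<noteq> 0" "k < n" using ij unfolding k_def by (auto simp: transpose_def)
  have \<pi>: "\<pi> permutes {..<n}"
    unfolding \<pi>_def using k n ij by (intro permutes_compose permutes_swap_id) auto
  have \<pi>01: "\<pi> 0 = j" "\<pi> 1 = i" using k by (auto simp: \<pi>_def k_def)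
  define B where "B = mat n n (\<lambda>(i,j). A $$ (\<pi> i, \<pi> j))"
  have B: "similar_mat A B" "B \<in> carrier_mat n n" "B $$ (1,0) \<noteq> 0"
    unfolding B_def using similar_mat_permute[OF A(2) \<pi>] \<pi>01 ij n by auto
  define w where "w i = (if i = 0 then B $$ (0,0) - p else B $$ (i,0))" for i
  define N where "N = column_conjugate n 1 w B"
  have "similar_mat B N"
    unfolding N_def using B n by (intro column_conjugate_similar) (auto simp: w_def)
  then have "similar_mat M N" using A(1) B(1) similar_mat_trans by blast
  then show ?thesis
    by (rule that) (use n B in \<open>auto simp: N_def column_conjugate_def Let_def w_def mult.assoc\<close>)
qed

definition schur :: "nat \<Rightarrow> 'a::division_ring mat \<Rightarrow> 'a mat" where
  "schur m M = mat m m (\<lambda>(i,j). M $$ (Suc i, Suc j) - M $$ (Suc i, 0) * inverse (M $$ (0,0)) * M $$ (0, Suc j))"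

lemma similar_schur:
  fixes M :: "'a::division_ring mat"
  assumes M: "M \<in> carrier_mat (Suc m) (Suc m)" and m: "m \<ge> 2"
    and ns: "\<not> central_scalar (Suc m) M" and p: "p \<noteq> 0"
  obtains N where "similar_mat M N" "N \<in> carrier_mat (Suc m) (Suc m)" "N $$ (0,0) = p"
    "schur m N = 0\<^sub>m m m \<or> \<not> central_scalar m (schur m N)"
proof -
  obtain N where N: "similar_mat M N" "N \<in> carrier_mat (Suc m) (Suc m)" "N $$ (0,0) = p"
    "N $$ (1,0) = 1" "\<And>i. 2 \<le> i \<Longrightarrow> i < Suc m \<Longrightarrow> N $$ (i,0) = 0"
    using similar_first_column[OF M _ ns, of p] m by auto
  show ?thesis
  proof (cases "schur m N = 0\<^sub>m m m \<or> \<not> central_scalar m (schur m N)")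
    case True
    then show ?thesis using that N by blast
  next
    case False
    txt \<open>If the Schur complement is a nonzero scalar, conjugating by the transvection that adds
      row 2 to row 0 makes it nonscalar.\<close>
    then obtain z where "schur m N = z \<cdot>\<^sub>m 1\<^sub>m m" "schur m N \<noteq> 0\<^sub>m m m"
      unfolding central_scalar_def by auto
    moreover have "0 \<cdot>\<^sub>m 1\<^sub>m m = (0\<^sub>m m m :: 'a mat)" by (rule eq_matI) auto
    ultimately have z: "schur m N = z \<cdot>\<^sub>m 1\<^sub>m m" "z \<noteq> 0" by auto
    have S: "N $$ (Suc i, Suc j) - N $$ (Suc i, 0) * inverse p * N $$ (0, Suc j) = (if i = j then z else 0)"
      if "i < m" "j < m" for i j
      using arg_cong[OF z(1), of "\<lambda>A. A $$ (i,j)"] that N(3) by (simp add: schur_def)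
    \<comment> \<open>These two entries of the scalar Schur complement are all that the new entry at
      \<open>(0,1)\<close> depends on.\<close>
    have S12: "N $$ (1,2) = inverse p * N $$ (0,2)" using S[of 0 1] N(4) m by (simp add: numeral_2_eq_2)
    have S22: "N $$ (2,2) = z" using S[of 1 1] N(5)[of 2] m by (simp add: numeral_2_eq_2)
    define w where "w i = (if i = 2 then 1 else if i = 0 then - 1 else (0::'a))" for i :: nat
    define L where "L = column_conjugate (Suc m) 2 w N"
    have sum_w: "(\<Sum>t<Suc m. f t * w t) = f 2 - f 0" for f :: "nat \<Rightarrow> 'a"
    proof -
      have "(\<Sum>t<Suc m. f t * w t) = (\<Sum>t\<in>{0,2}. f t * w t)"
        using m by (intro sum.mono_neutral_right) (auto simp: w_def)
      then show ?thesis by (simp add: w_def)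
    qed
    have wv: "w 0 = - 1" "w 1 = 0" "w (Suc 0) = 0" "w 2 = 1" by (auto simp: w_def)
    \<comment> \<open>Column 0 survives the conjugation because
      \<open>N $$ (2,0) = 0\<close>.\<close>
    have L: "L $$ (0,0) = p" "L $$ (1,0) = 1" "L $$ (1,2) = N $$ (1,2) - 1"
      "L $$ (0,2) = N $$ (0,2) - p + z"
      using m N(3-5) S22 wv
      by (auto simp: L_def column_conjugate_def Let_def sum_w simp del: sum.lessThan_Suc)
    have "schur m L $$ (0,1) = L $$ (1,2) - L $$ (1,0) * inverse p * L $$ (0,2)"
      using m L(1) by (simp add: schur_def numeral_2_eq_2)
    also have "\<dots> = - (inverse p * z)"
      unfolding L S12 using p by (simp add: right_diff_distrib distrib_left)
    finally have "schur m L $$ (0,1) \<noteq> 0" using p z(2) by simp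
    then have "\<not> central_scalar m (schur m L)" using central_scalar_off_diagonal[of m "schur m L" 0 1] m by auto
    moreover have "similar_mat N L"
      unfolding L_def using N(2) m by (intro column_conjugate_similar) (auto simp: w_def)
    moreover have "L \<in> carrier_mat (Suc m) (Suc m)" by (simp add: L_def column_conjugate_def Let_def)
    ultimately show ?thesis using that N(1) L(1) similar_mat_trans by blast
  qed
qed

section \<open>Factorization\<close>

text \<open>Block LU factorization: conjugating the lower block by the matrices that take the Schur
  complement to \<open>X * Y\<close> leaves the corner \<open>p\<close> fixed, and the result splits
  with \<open>X\<close> and \<open>Y\<close> as the lower right blocks of the two factors.\<close>

lemma similar_product_extend:
  fixes N :: "'a::division_ring mat"
  assumes N: "N \<in> carrier_mat (Suc m) (Suc m)" "N $$ (0,0) = p" "p \<noteq> 0"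
    and XY: "X \<in> carrier_mat m m" "Y \<in> carrier_mat m m" "similar_mat (schur m N) (X * Y)"
  obtains C R where "C \<in> carrier_mat m 1" "R \<in> carrier_mat 1 m"
    "similar_mat N (four_block_mat (1\<^sub>m 1) (0\<^sub>m 1 m) C X * four_block_mat (p \<cdot>\<^sub>m 1\<^sub>m 1) R (0\<^sub>m m 1) Y)"
proof -
  define A where "A = p \<cdot>\<^sub>m 1\<^sub>m 1"
  define A' where "A' = inverse p \<cdot>\<^sub>m 1\<^sub>m 1"
  define R where "R = mat 1 m (\<lambda>(i,j). N $$ (0, Suc j))"
  define U where "U = mat m 1 (\<lambda>(i,j). N $$ (Suc i, 0))"
  define D where "D = mat m m (\<lambda>(i,j). N $$ (Suc i, Suc j))"
  have c: "A \<in> carrier_mat 1 1" "A' \<in> carrier_mat 1 1" "R \<in> carrier_mat 1 m"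
    "U \<in> carrier_mat m 1" "D \<in> carrier_mat m m"
    by (auto simp: A_def A'_def R_def U_def D_def)
  have N_eq: "N = four_block_mat A R U D"
    by (rule eq_matI) (use N c in \<open>auto simp: A_def R_def U_def D_def less_Suc_eq_0_disj\<close>)
  have A'A: "A' * A = 1\<^sub>m 1"
    by (rule eq_matI) (use N(3) in \<open>auto simp: A_def A'_def scalar_prod_def\<close>)
  have S: "schur m N = D - U * A' * R"
    by (rule eq_matI) (use c N in \<open>auto simp: schur_def A'_def R_def U_def D_def scalar_prod_def\<close>)
  obtain P Q where PQ: "similar_mat_wit (X * Y) (schur m N) P Q"
    using similar_mat_sym[OF XY(3)] unfolding similar_mat_def by blast
  note w = similar_mat_witD2[OF mult_carrier_mat[OF XY(1,2)] PQ]
  have "similar_mat_wit (P * D * Q) D P Q" using w c by (intro similar_mat_witI[of _ _ m]) auto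
  then have "similar_mat_wit (four_block_mat A (R * Q) (P * U) (P * D * Q)) N
    (four_block_mat (1\<^sub>m 1) (0\<^sub>m 1 m) (0\<^sub>m m 1) P) (four_block_mat (1\<^sub>m 1) (0\<^sub>m 1 m) (0\<^sub>m m 1) Q)"
    unfolding N_eq using c w
    by (intro similar_mat_wit_four_block[OF similar_mat_wit_refl]) auto
  then have sim: "similar_mat N (four_block_mat A (R * Q) (P * U) (P * D * Q))"
    using similar_mat_sym unfolding similar_mat_def by blast
  \<comment> \<open>The conjugated lower block is the rank-one correction plus the conjugated Schur
    complement, exactly the lower right block of the product of the two factors.\<close>
  have D: "P * D * Q = P * U * A' * (R * Q) + X * Y"
  proof -
    have "P * D * Q = P * (U * A' * R + schur m N) * Q"
      unfolding S using c by (intro arg_cong[of _ _ "\<lambda>x. P * x * Q"] eq_matI) auto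
    also have "\<dots> = P * (U * A' * R) * Q + P * schur m N * Q"
      using c w(5-7) by (simp add: mult_add_distrib_mat[of _ m m _ m] add_mult_distrib_mat[of _ m m _ _ m])
    also have "P * (U * A' * R) * Q = P * U * A' * (R * Q)"
      using c w(6,7) by (simp add: assoc_mult_mat[of _ m m _ 1 _ m] assoc_mult_mat[of _ m m _ 1 _ 1]
        assoc_mult_mat[of _ m 1 _ m _ m] assoc_mult_mat[of _ m m _ m _ m]
        assoc_mult_mat[of _ m 1 _ 1 _ m]
        assoc_mult_mat[of _ 1 1 _ m _ m])
    finally show ?thesis using w(3) by simp
  qed
  have "P * U * A' * A = P * U"
    using assoc_mult_mat[of "P * U" m 1 A' 1 A 1] c(1,2,4) w(6) unfolding A'A by auto
  then have "four_block_mat (1\<^sub>m 1) (0\<^sub>m 1 m) (P * U * A') X * four_block_mat A (R * Q) (0\<^sub>m m 1) Y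
    = four_block_mat A (R * Q) (P * U) (P * D * Q)"
    using c XY(1,2) w(6,7) unfolding D
    by (subst mult_four_block_mat[of _ 1 1 _ m _ m _ _ 1 _ m])
      (auto intro!: arg_cong2[of _ _ _ _ "\<lambda>B C. four_block_mat A B C _"])
  with sim have "similar_mat N (four_block_mat (1\<^sub>m 1) (0\<^sub>m 1 m) (P * U * A') X
      * four_block_mat (p \<cdot>\<^sub>m 1\<^sub>m 1) (R * Q) (0\<^sub>m m 1) Y)"
    unfolding A_def by simp
  then show ?thesis by (rule that[rotated 2]) (use c w(6,7) in auto)
qed


section \<open>The 2 x 2 base case and the induction on the size\<close>

definition mat22 :: "'a \<Rightarrow> 'a \<Rightarrow> 'a \<Rightarrow> 'a \<Rightarrow> 'a mat" where
  "mat22 a b c d = mat 2 2 (\<lambda>(i,j). if i = 0 then if j = 0 then a else b else if j = 0 then c else d)"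

lemma mat22_carrier[simp]: "mat22 a b c d \<in> carrier_mat 2 2"
  by (simp add: mat22_def)

lemma mat22_entry[simp]:
  "mat22 a b c d $$ (0,0) = a" "mat22 a b c d $$ (0,Suc 0) = b"
  "mat22 a b c d $$ (Suc 0,0) = c" "mat22 a b c d $$ (Suc 0,Suc 0) = d"
  by (simp_all add: mat22_def)

lemma mat22_eqI:
  assumes "A \<in> carrier_mat 2 2" "A $$ (0,0) = a" "A $$ (0,1) = b" "A $$ (1,0) = c" "A $$ (1,1) = d"
  shows "A = mat22 a b c d"
  by (rule eq_matI) (use assms in \<open>auto simp: mat22_def less_2_cases_iff\<close>)

lemma mat22_mult:
  "mat22 a b c d * mat22 a' b' c' d' =
     mat22 (a * a' + b * c') (a * b' + b * d') (c * a' + d * c') (c * b' + d * (d'::'a::ring_1))"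
proof -
  have "(\<Sum>k<2. f k) = f 0 + f 1" for f :: "nat \<Rightarrow> 'a" by (simp add: numeral_2_eq_2)
  then show ?thesis
    by (intro mat22_eqI)
      (auto simp: mult_mat_entry[OF mat22_carrier mat22_carrier] mult_carrier_mat[OF mat22_carrier mat22_carrier]
        simp del: index_mult_mat(1))
qed

lemma mat22_minus:
  "mat22 a b c d - mat22 a' b' c' d' = mat22 (a - a') (b - b') (c - c') (d - (d'::'a::ring_1))"
  by (rule mat22_eqI) (auto intro!: minus_carrier_mat index_minus_mat(1) simp: mat22_def)

lemma similar_companion22:
  fixes M :: "'a::division_ring mat"
  assumes "M \<in> carrier_mat 2 2" "\<not> central_scalar 2 M"
  obtains a b where "similar_mat M (mat22 0 a 1 b)"
proof -
  obtain N where N: "similar_mat M N" "N \<in> carrier_mat 2 2" "N $$ (0,0) = 0" "N $$ (1,0) = 1"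
    using similar_first_column[OF assms(1) _ assms(2), of 0] by auto
  have "N = mat22 0 (N $$ (0,1)) 1 (N $$ (1,1))"
    by (rule mat22_eqI) (use N in auto)
  then show ?thesis using that N(1) by metis
qed

text \<open>The parameters \<open>c\<close> and \<open>e\<close> are what makes the trace of the upper triangular factor adjustable
  after \<open>a\<close> is known.\<close>

lemma companion22_similar_product:
  fixes a :: "'a::division_ring"
  assumes "c \<noteq> 0" "e \<noteq> 0"
  obtains y where "similar_mat (mat22 0 a 1 b)
    (mat22 s e c 0 * mat22 (inverse c) y 0 (inverse e * a))"
proof -
  \<comment> \<open>The first column of the target product is (s c^-1, 1), which dictates
    \<open>x\<close>; its bottom row then forces \<open>c * y = b - x\<close>.\<close>
  define x where "x = s * inverse c"
  define w where "w i = (if i = 0 then - x else 1)" for i :: nat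
  have "column_conjugate 2 1 w (mat22 0 a 1 b) = mat22 x (a + x * (b - x)) 1 (b - x)"
    by (rule mat22_eqI)
      (auto simp: column_conjugate_def Let_def w_def numeral_2_eq_2 algebra_simps)
  also have "\<dots> = mat22 s e c 0 * mat22 (inverse c) (inverse c * (b - x)) 0 (inverse e * a)"
    unfolding mat22_mult using assms by (simp add: x_def mult.assoc[symmetric] add.commute)
  finally show ?thesis
    using column_conjugate_similar[of "mat22 0 a 1 b" 2 1 w] that by (auto simp: w_def)
qed

text \<open>The first trace is \<open>s\<close> whatever \<open>c\<close> and \<open>e\<close> are,
  so only \<open>inverse c + inverse e * a = w\<close> has to be solved with nonzero
  \<open>c\<close> and \<open>e\<close>. This fails only for \<open>a = w = 0\<close>.\<close>

lemma similar_almost_lower_upper22: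
  fixes M :: "'a::division_ring mat"
  assumes sim: "similar_mat M (mat22 0 a 1 b)" and w: "w \<noteq> 0 \<or> a \<noteq> 0"
    and t: "(t::'a) \<noteq> 0" "t \<noteq> 1"
  obtains X Y where "X \<in> carrier_mat 2 2" "Y \<in> carrier_mat 2 2" "similar_mat M (X * Y)"
    "almost_lower 2 X" "upper_triangular Y" "(\<Sum>i<2. X $$ (i,i)) = s" "(\<Sum>i<2. Y $$ (i,i)) = w"
proof -
  have "\<exists>c e. c \<noteq> 0 \<and> e \<noteq> 0 \<and> inverse c + inverse e * a = w"
  proof (cases "a = 0")
    case True
    then show ?thesis using w by (intro exI[of _ "inverse w"] exI[of _ 1]) auto
  next
    case False
    \<comment> \<open>\<open>v\<close> becomes \<open>inverse c\<close> and must avoid both 0 and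
      \<open>w\<close>; \<open>t\<close> is the substitute when \<open>w = 1\<close>.\<close>
    define v where "v = (if w = 1 then t else 1)"
    have v: "v \<noteq> 0" "w - v \<noteq> 0" using t by (auto simp: v_def)
    have "inverse v \<noteq> 0" "inverse ((w - v) * inverse a) \<noteq> 0"
      "inverse (inverse v) + inverse (inverse ((w - v) * inverse a)) * a = w"
      using v False by (auto simp: mult.assoc)
    then show ?thesis by blast
  qed
  then obtain c e where ce: "c \<noteq> 0" "e \<noteq> 0" "inverse c + inverse e * a = w" by blast
  obtain y where "similar_mat (mat22 0 a 1 b) (mat22 s e c 0 * mat22 (inverse c) y 0 (inverse e * a))"
    using companion22_similar_product[OF ce(1,2)] .
  with sim have "similar_mat M (mat22 s e c 0 * mat22 (inverse c) y 0 (inverse e * a))"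
    by (rule similar_mat_trans)
  then show ?thesis
    by (rule that[rotated 2]) (use ce(3) in \<open>auto simp: almost_lower_def upper_triangular_def
      numeral_2_eq_2 less_Suc_eq mat22_def\<close>)
qed

text \<open>Each step splits off diagonal entries 1 and \<open>p\<close> from the two factors, so
  the remaining traces to be met are \<open>s - 1\<close> and \<open>w - p\<close>. Prescribing
  arbitrary traces lets the induction absorb this shift.\<close>

lemma similar_almost_lower_upper:
  fixes M :: "'a::division_ring mat" and s w t :: 'a
  assumes "n \<ge> 2" "M \<in> carrier_mat n n" "\<not> central_scalar n M" "n > 2 \<or> w \<noteq> 0"
    and t: "t \<noteq> 0" "t \<noteq> 1"
  shows "\<exists>X\<in>carrier_mat n n. \<exists>Y\<in>carrier_mat n n. similar_mat M (X * Y) \<and> almost_lower n X \<and>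
    upper_triangular Y \<and> (\<Sum>i<n. X $$ (i,i)) = s \<and> (\<Sum>i<n. Y $$ (i,i)) = w"
  using assms(1-4)
proof (induction n arbitrary: M s w rule: nat_induct_at_least)
  case base
  obtain a b where "similar_mat M (mat22 0 a 1 b)"
    using similar_companion22[OF base(1,2)] .
  then show ?case
    using similar_almost_lower_upper22[of M a b w t s] base(3) t by blast
next
  case (Suc m)
  \<comment> \<open>Besides being invertible, \<open>p\<close> must differ from \<open>w\<close>:
    the remaining trace \<open>w - p\<close> is then nonzero, as the induction hypothesis demands at
    size 2.\<close>
  define p where "p = (if w = 1 then t else 1)"
  have p: "p \<noteq> 0" "w - p \<noteq> 0" using t by (auto simp: p_def)
  obtain N where N: "similar_mat M N" "N \<in> carrier_mat (Suc m) (Suc m)" "N $$ (0,0) = p"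
    "schur m N = 0\<^sub>m m m \<or> \<not> central_scalar m (schur m N)"
    using similar_schur[OF Suc.prems(1) Suc.hyps Suc.prems(2) p(1)] .
  have S: "schur m N \<in> carrier_mat m m" by (simp add: schur_def)
  have "\<exists>X\<in>carrier_mat m m. \<exists>Y\<in>carrier_mat m m. similar_mat (schur m N) (X * Y) \<and> almost_lower m X \<and>
    upper_triangular Y \<and> (\<Sum>i<m. X $$ (i,i)) = s - 1 \<and> (\<Sum>i<m. Y $$ (i,i)) = w - p"
  proof (cases "schur m N = 0\<^sub>m m m")
    case True
    \<comment> \<open>The two diagonal units sit at different positions, so the product is zero
      while both traces are as prescribed. Since \<open>m\<close> is at least 2, both positions
      exist and the last diagonal entry of \<open>X\<close> is zero.\<close>
    define X where "X = mat m m (\<lambda>(i,j). if i = 0 \<and> j = 0 then s - 1 else 0)"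
    define Y where "Y = mat m m (\<lambda>(i,j). if i = 1 \<and> j = 1 then w - p else 0)"
    have XY: "X \<in> carrier_mat m m" "Y \<in> carrier_mat m m" by (auto simp: X_def Y_def)
    have "X * Y = 0\<^sub>m m m"
    proof (rule eq_matI)
      fix i j assume "i < dim_row (0\<^sub>m m m)" "j < dim_col (0\<^sub>m m m)"
      then show "(X * Y) $$ (i,j) = 0\<^sub>m m m $$ (i,j)"
        by (simp add: mult_mat_entry[OF XY]) (auto simp: X_def Y_def intro!: sum.neutral)
    qed (use XY in auto)
    then have "similar_mat (schur m N) (X * Y)" using True similar_mat_refl[OF S] by simp
    moreover have "almost_lower m X" "upper_triangular Y"
      using Suc.hyps by (auto simp: X_def Y_def almost_lower_def upper_triangular_def)
    moreover have "(\<Sum>i<m. X $$ (i,i)) = (\<Sum>i<m. if i = 0 then s - 1 else 0)"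
      "(\<Sum>i<m. Y $$ (i,i)) = (\<Sum>i<m. if i = 1 then w - p else 0)"
      by (auto simp: X_def Y_def intro!: sum.cong)
    ultimately show ?thesis using XY Suc.hyps by (intro bexI[of _ X] bexI[of _ Y]) auto
  next
    case False
    then show ?thesis using Suc.IH[OF S, of "w - p" "s - 1"] N(4) p(2) by auto
  qed
  then obtain X Y where XY: "X \<in> carrier_mat m m" "Y \<in> carrier_mat m m" "similar_mat (schur m N) (X * Y)"
    and X: "almost_lower m X" "(\<Sum>i<m. X $$ (i,i)) = s - 1"
    and Y: "upper_triangular Y" "(\<Sum>i<m. Y $$ (i,i)) = w - p" by blast
  obtain C R where CR: "C \<in> carrier_mat m 1" "R \<in> carrier_mat 1 m"
    "similar_mat N (four_block_mat (1\<^sub>m 1) (0\<^sub>m 1 m) C X * four_block_mat (p \<cdot>\<^sub>m 1\<^sub>m 1) R (0\<^sub>m m 1) Y)"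
    using similar_product_extend[OF N(2,3) p(1) XY] .
  define X' where "X' = four_block_mat (1\<^sub>m 1) (0\<^sub>m 1 m) C X"
  define Y' where "Y' = four_block_mat (p \<cdot>\<^sub>m 1\<^sub>m 1) R (0\<^sub>m m 1) Y"
  have c: "X' \<in> carrier_mat (Suc m) (Suc m)" "Y' \<in> carrier_mat (Suc m) (Suc m)"
    using XY by (auto simp: X'_def Y'_def)
  have diag: "X' $$ (0,0) = 1" "Y' $$ (0,0) = p"
    "\<And>i. i < m \<Longrightarrow> X' $$ (Suc i, Suc i) = X $$ (i,i)" "\<And>i. i < m \<Longrightarrow> Y' $$ (Suc i, Suc i) = Y $$ (i,i)"
    using XY by (auto simp: X'_def Y'_def)
  have "similar_mat M (X' * Y')"
    using similar_mat_trans[OF N(1) CR(3)] by (simp add: X'_def Y'_def)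
  moreover have "almost_lower (Suc m) X'"
    unfolding almost_lower_def
  proof (intro conjI allI impI)
    show "X' $$ (Suc m - 1, Suc m - 1) = 0"
      using X(1) diag(3)[of "m - 1"] Suc.hyps unfolding almost_lower_def by simp
    fix i j assume ij: "i < j" "j < Suc m" "\<not> (Suc j = Suc m \<and> Suc i = j)"
    show "X' $$ (i,j) = 0"
    proof (cases i)
      case 0
      then show ?thesis using ij XY by (auto simp: X'_def)
    next
      case (Suc k)
      then obtain l where "j = Suc l" using ij by (cases j) auto
      then have "X $$ (k, j - 1) = 0" using X(1) ij Suc unfolding almost_lower_def by auto
      then show ?thesis using ij Suc XY by (simp add: X'_def)
    qed
  qed
  moreover have "upper_triangular Y'"
    using Y(1) XY(2) CR(2) unfolding upper_triangular_def Y'_def by auto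
  moreover have "(\<Sum>i<Suc m. X' $$ (i,i)) = s" "(\<Sum>i<Suc m. Y' $$ (i,i)) = w"
    unfolding sum.lessThan_Suc_shift using diag X(2) Y(2) by auto
  ultimately show ?case using c by blast
qed

section \<open>Exceptional and scalar matrices, and the conclusion\<close>

lemma commutator_product_singular22:
  fixes b :: "'a::division_ring"
  shows "commutator_product 2 (mat22 0 0 1 b)"
proof -
  have X: "mat_commutator 2 (mat22 0 0 1 (0::'a))"
    by (rule mat_commutatorI[of "mat22 0 0 1 0" _ "mat22 1 0 0 0"]) (auto simp: mat22_mult mat22_minus)
  show ?thesis
  proof (cases "b = 0")
    case True
    have "mat_commutator 2 (mat22 1 0 0 (- 1::'a))"
      by (rule mat_commutatorI[of "mat22 0 1 0 0" _ "mat22 0 0 1 0"]) (auto simp: mat22_mult mat22_minus)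
    moreover have "mat22 0 0 1 b = mat22 0 0 1 0 * mat22 1 0 0 (- 1)"
      using True by (simp add: mat22_mult)
    ultimately show ?thesis using X unfolding commutator_product_def by blast
  next
    case False
    \<comment> \<open>Left multiplication by the first factor sees only the top row (1, b), so the
      bottom row is free. It is chosen to make the matrix a column times a row whose product in the
      reverse order is 1 - b b^-1 = 0; hence one of the two products in the commutator
      vanishes.\<close>
    then have "mat_commutator 2 (mat22 1 b (- inverse b) (- 1))"
      by (intro mat_commutatorI[of "mat22 1 0 (- inverse b) 0" _ "mat22 1 b 0 0"])
        (auto simp: mat22_mult mat22_minus)
    moreover have "mat22 0 0 1 b = mat22 0 0 1 0 * mat22 1 b (- inverse b) (- 1)"
      by (simp add: mat22_mult)
    ultimately show ?thesis using X unfolding commutator_product_def by blast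
  qed
qed

lemma commutator_product_scalar:
  fixes z :: "'a::division_ring" and d :: "nat \<Rightarrow> 'a"
  assumes n: "n \<ge> 2" and d: "inj_on d {..<n}" "\<And>i. i < n \<Longrightarrow> d i \<in> ring_center"
  shows "commutator_product n (z \<cdot>\<^sub>m 1\<^sub>m n)"
proof -
  \<comment> \<open>\<open>r\<close> is a cyclic shift, free of fixed points because
    \<open>n\<close> is at least 2, so \<open>X\<close> and \<open>Y\<close> have zero diagonal.
    \<open>Y\<close> is \<open>z\<close> times the inverse of the permutation matrix
    \<open>X\<close>.\<close>
  define r where "r i = (if i = 0 then n - 1 else i - 1)" for i
  have r: "r i < n" "r i \<noteq> i" if "i < n" for i using that n by (auto simp: r_def)
  have r_inj: "r i = r j \<longleftrightarrow> i = j" if "i < n" "j < n" for i j using that by (auto simp: r_def)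
  define X where "X = mat n n (\<lambda>(i,j). if j = r i then 1 else (0::'a))"
  define Y where "Y = mat n n (\<lambda>(i,j). if i = r j then z else 0)"
  have c: "X \<in> carrier_mat n n" "Y \<in> carrier_mat n n" by (auto simp: X_def Y_def)
  have "mat_commutator n X" "mat_commutator n Y"
    by (rule zero_diagonal_mat_commutator[OF _ _ d]; use r in \<open>force simp: X_def Y_def\<close>)+
  moreover have "z \<cdot>\<^sub>m 1\<^sub>m n = X * Y"
  proof (rule eq_matI)
    fix i j assume "i < dim_row (X * Y)" "j < dim_col (X * Y)"
    then have ij: "i < n" "j < n" using c by auto
    have "(X * Y) $$ (i,j) = (if r i = r j then z else 0)"
      using ij r(1)[OF ij(1)] by (subst mult_mat_entry[OF c])
        (auto simp: X_def Y_def if_distrib[of "\<lambda>x. x * _"] cong: if_cong)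
    then show "(z \<cdot>\<^sub>m 1\<^sub>m n) $$ (i,j) = (X * Y) $$ (i,j)"
      using ij r r_inj[OF ij] by simp
  qed (use c in auto)
  ultimately show ?thesis unfolding commutator_product_def by blast
qed

lemma commutator_product_nonscalar:
  fixes M :: "'a::division_ring mat" and t :: 'a
  assumes n: "n \<ge> 2" and M: "M \<in> carrier_mat n n" "\<not> central_scalar n M"
    and t: "t \<noteq> 0" "t \<noteq> 1"
  shows "commutator_product n M"
proof -
  have product: "commutator_product n M"
    if "X \<in> carrier_mat n n" "Y \<in> carrier_mat n n" "similar_mat M (X * Y)" "almost_lower n X"
      "upper_triangular Y" "(\<Sum>i<n. X $$ (i,i)) = 0" "(\<Sum>i<n. Y $$ (i,i)) = 0" for X Y
  proof (rule commutator_product_similar[OF that(3)])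
    show "commutator_product n (X * Y)"
      unfolding commutator_product_def
      using almost_lower_mat_commutator[OF that(1,4,6) n]
        upper_triangular_mat_commutator[OF that(2,5,7)] by blast
  qed
  show ?thesis
  proof (cases "n = 2")
    case True
    then obtain a b where ab: "similar_mat M (mat22 0 a 1 b)"
      using similar_companion22 M by metis
    show ?thesis
    proof (cases "a = 0")
      \<comment> \<open>Here a zero trace of the upper triangular factor would force
        \<open>inverse c = 0\<close>, so the explicit factorization takes over.\<close>
      case a: True
      then show ?thesis
        using commutator_product_similar[OF ab] commutator_product_singular22 True by auto
    next
      case False
      then obtain X Y where "X \<in> carrier_mat 2 2" "Y \<in> carrier_mat 2 2" "similar_mat M (X * Y)"
        "almost_lower 2 X" "upper_triangular Y" "(\<Sum>i<2. X $$ (i,i)) = 0" "(\<Sum>i<2. Y $$ (i,i)) = 0"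
        using similar_almost_lower_upper22[OF ab _ t, of 0 0] by auto
      then show ?thesis using product True by blast
    qed
  next
    case False
    then show ?thesis
      using similar_almost_lower_upper[OF n M _ t, of 0 0] n product by auto
  qed
qed

theorem theorem17:
  fixes n q :: nat and M :: "'a::division_ring mat"
  assumes "n \<ge> 2"
    and "finite (ring_center :: 'a set)"
    and "card (ring_center :: 'a set) = q"
    and "q > n"
    and "M \<in> carrier_mat n n"
  shows "\<exists>X Y. mat_commutator n X \<and> mat_commutator n Y \<and> M = X * Y"
proof -
  obtain d :: "nat \<Rightarrow> 'a" where d: "bij_betw d {..<q} ring_center"
    using ex_bij_betw_nat_finite[OF assms(2)] assms(3) by (auto simp: lessThan_atLeast0)
  have "inj_on d {..<n}" "\<And>i. i < n \<Longrightarrow> d i \<in> ring_center"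
    using d assms(4) by (auto simp: bij_betw_def intro: inj_on_subset)
  note scalar = commutator_product_scalar[OF assms(1) this]
  \<comment> \<open>The center has more than two elements, which supplies the \<open>t\<close> used
    to dodge a forbidden value when choosing pivots.\<close>
  have "\<not> (ring_center :: 'a set) \<subseteq> {0, 1}"
  proof
    assume "(ring_center :: 'a set) \<subseteq> {0, 1}"
    then have "q \<le> card {0, 1::'a}" using assms(3) by (metis card_mono finite.emptyI finite.insertI)
    then show False using assms(1,4) by simp
  qed
  then obtain t :: 'a where t: "t \<noteq> 0" "t \<noteq> 1" by blast
  have "commutator_product n M"
  proof (cases "central_scalar n M")
    case True
    then show ?thesis using scalar by (auto simp: central_scalar_def)
  next
    case False
    then show ?thesis using commutator_product_nonscalar[OF assms(1,5) _ t] by blast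
  qed
  then show ?thesis unfolding commutator_product_def .
qed

end
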